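(* Let $G$ be a graph. Then the following statements are equivalent: (1) $G$ is neighborhood perfect; (2) for all $k \in \mathbb{N}_0$ and all induced subgraphs $H$ of $G$, $H \in \varOmega_k$ if and only if $H\in \varUpsilon_k$.
   Context: All graphs are finite and simple. A graph is perfect if $\omega(H)=\chi(H)$ for each of its induced subgraphs $H$; a graph is neighborhood perfect if for every vertex $v$ the subgraph induced by the neighborhood $N(v)$ is perfect. $\Delta,\omega,\chi$ denote maximum degree, clique number, chromatic number. For $k\in\mathbb{N}_0$: $\varOmega_k$ is the class of graphs $G$ such that every induced subgraph $H$ of $G$ (including $G$) satisfies $\Delta(H)\le\omega(H)+k-1$; $\varUpsilon_k$ is the class of graphs $G$ such that every induced subgraph $H$ of $G$ (including $G$) satisfies $\Delta(H)\le\chi(H)+k-1$. *)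

theory Defs
  imports "Graph_Theory.Graph_Theory"
begin

text \<open>
  A finite simple graph is the locale \<open>graph\<close>: a finite, symmetric, loop-free digraph without
  parallel arcs, so each undirected edge is a pair of opposite arcs. The null graph is
  allowed; it has to be, since the neighbourhood of an isolated vertex is empty.
\<close>

definition neighborhood :: "('a, 'b) pre_digraph \<Rightarrow> 'a \<Rightarrow> 'a set" where
  "neighborhood G v = {u \<in> verts G. v \<rightarrow>\<^bsub>G\<^esub> u}"

text \<open>
  The out-degree counts each incident undirected edge once. The value for the null graph is
  the unspecified \<open>Max {}\<close>.
\<close>

definition max_degree :: "('a, 'b) pre_digraph \<Rightarrow> nat" where
  "max_degree G = Max (out_degree G ` verts G)"

definition is_clique :: "('a, 'b) pre_digraph \<Rightarrow> 'a set \<Rightarrow> bool" where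
  "is_clique G S \<longleftrightarrow> S \<subseteq> verts G \<and> (\<forall>u\<in>S. \<forall>v\<in>S. u \<noteq> v \<longrightarrow> u \<rightarrow>\<^bsub>G\<^esub> v)"

definition clique_number :: "('a, 'b) pre_digraph \<Rightarrow> nat" where
  "clique_number G = Max (card ` {S. is_clique G S})"

definition proper_coloring :: "('a, 'b) pre_digraph \<Rightarrow> nat \<Rightarrow> ('a \<Rightarrow> nat) \<Rightarrow> bool" where
  "proper_coloring G k c \<longleftrightarrow>
     (\<forall>v\<in>verts G. c v < k) \<and> (\<forall>u\<in>verts G. \<forall>v\<in>verts G. u \<rightarrow>\<^bsub>G\<^esub> v \<longrightarrow> c u \<noteq> c v)"

definition chromatic_number :: "('a, 'b) pre_digraph \<Rightarrow> nat" where
  "chromatic_number G = (LEAST k. \<exists>c. proper_coloring G k c)"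

definition perfect_graph :: "('a, 'b) pre_digraph \<Rightarrow> bool" where
  "perfect_graph G \<longleftrightarrow> (\<forall>H. induced_subgraph H G \<longrightarrow> clique_number H = chromatic_number H)"

definition neighborhood_perfect :: "('a, 'b) pre_digraph \<Rightarrow> bool" where
  "neighborhood_perfect G \<longleftrightarrow> (\<forall>v\<in>verts G. perfect_graph (G \<restriction> neighborhood G v))"

text \<open>
  The null graph has no maximum degree, so the inequalities range over the induced subgraphs
  with at least one vertex. They are stated over the integers, where \<open>- 1\<close> does not truncate.
\<close>

definition Omega_class :: "nat \<Rightarrow> ('a, 'b) pre_digraph set" where
  "Omega_class k = {G. graph G \<and>
     (\<forall>H. induced_subgraph H G \<and> verts H \<noteq> {} \<longrightarrow>
        int (max_degree H) \<le> int (clique_number H) + int k - 1)}"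

definition Upsilon_class :: "nat \<Rightarrow> ('a, 'b) pre_digraph set" where
  "Upsilon_class k = {G. graph G \<and>
     (\<forall>H. induced_subgraph H G \<and> verts H \<noteq> {} \<longrightarrow>
        int (max_degree H) \<le> int (chromatic_number H) + int k - 1)}"

end

theory Submission
  imports Defs
begin

text \<open>
  For a vertex \<open>v\<close> of maximum degree in \<open>F\<close>, passing to the closed neighbourhood of \<open>v\<close> keeps
  the maximum degree. There \<open>v\<close> is dominating, so clique and chromatic number both exceed those
  of the open neighbourhood by one, and they agree if that neighbourhood is perfect.

  Conversely, let \<open>W\<close> be a set of neighbours of \<open>v\<close> with \<open>\<omega>(G[W]) < \<chi>(G[W])\<close> and put
  \<open>H = G[W \<union> {v}]\<close>. The quantity \<open>|S| - \<chi>(G[S])\<close> is monotone in \<open>S\<close>, which shows that \<open>H\<close> lies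
  in \<open>Upsilon_class k\<close> for \<open>k = |W| - \<chi>(G[W])\<close>, while \<open>H\<close> itself violates the bound for
  \<open>Omega_class k\<close>.
\<close>

section \<open>Induced subgraphs\<close>

lemma adj_induce_iff:
  "u \<rightarrow>\<^bsub>G \<restriction> S\<^esub> v \<longleftrightarrow> u \<in> S \<and> v \<in> S \<and> u \<rightarrow>\<^bsub>G\<^esub> v"
  by (auto simp: arcs_ends_def arc_to_ends_def)

lemma induce_induce: "S \<subseteq> T \<Longrightarrow> (G \<restriction> T) \<restriction> S = G \<restriction> S"
  by (auto simp: induce_subgraph_def)

text \<open>\<open>compatible\<close> forces \<open>tail\<close> and \<open>head\<close> of
  \<open>H\<close> to be those of \<open>G\<close>, so an induced subgraph is determined as a record
  by its vertex set.\<close>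

lemma (in wf_digraph) induced_subgraph_iff:
  "induced_subgraph H G \<longleftrightarrow> verts H \<subseteq> verts G \<and> H = G \<restriction> verts H"
proof
  assume "induced_subgraph H G"
  then show "verts H \<subseteq> verts G \<and> H = G \<restriction> verts H"
    by (auto simp: induced_subgraph_def subgraph_def compatible_def induce_subgraph_def)
next
  assume "verts H \<subseteq> verts G \<and> H = G \<restriction> verts H"
  then show "induced_subgraph H G"
    using induced_induce by metis
qed

lemma (in wf_digraph) all_induced_subgraph_iff:
  "(\<forall>H. induced_subgraph H G \<longrightarrow> P H) \<longleftrightarrow> (\<forall>S\<subseteq>verts G. P (G \<restriction> S))"
proof (intro iffI allI impI)
  fix H assume P: "\<forall>S\<subseteq>verts G. P (G \<restriction> S)" and "induced_subgraph H G"
  then have H: "verts H \<subseteq> verts G" "H = G \<restriction> verts H" unfolding induced_subgraph_iff by auto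
  from P H(1) have "P (G \<restriction> verts H)" by blast
  with H(2) show "P H" by (rule ssubst)
qed auto

lemma graph_induce:
  assumes "graph G" "S \<subseteq> verts G"
  shows "graph (G \<restriction> S)"
proof -
  interpret graph G by fact
  have ind: "induced_subgraph (G \<restriction> S) G" using assms(2) by (rule induced_induce)
  interpret GS: digraph "G \<restriction> S" using ind by (rule digraphI_induced)
  interpret GS: sym_digraph "G \<restriction> S" using ind by (rule induced_graph_imp_graph)
  show ?thesis by unfold_locales
qed

lemma perfect_graph_iff:
  assumes "graph G"
  shows "perfect_graph G \<longleftrightarrow>
    (\<forall>S\<subseteq>verts G. clique_number (G \<restriction> S) = chromatic_number (G \<restriction> S))"
proof -
  interpret graph G by fact
  show ?thesis unfolding perfect_graph_def by (rule all_induced_subgraph_iff)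
qed

text \<open>Moving the integer \<open>- 1\<close> across the inequality gives a strict bound between
  naturals, so no subtraction is left for later arguments.\<close>

lemma Omega_class_iff:
  assumes "graph G"
  shows "G \<in> Omega_class k \<longleftrightarrow> (\<forall>S\<subseteq>verts G. S \<noteq> {} \<longrightarrow>
    max_degree (G \<restriction> S) < clique_number (G \<restriction> S) + k)"
proof -
  interpret graph G by fact
  have "\<And>a b. int a \<le> int b + int k - 1 \<longleftrightarrow> a < b + k" by linarith
  with assms show ?thesis
    using all_induced_subgraph_iff[of "\<lambda>H. verts H \<noteq> {} \<longrightarrow>
      max_degree H < clique_number H + k"]
    by (simp add: Omega_class_def imp_conjL)
qed

lemma Upsilon_class_iff:
  assumes "graph G"
  shows "G \<in> Upsilon_class k \<longleftrightarrow> (\<forall>S\<subseteq>verts G. S \<noteq> {} \<longrightarrow>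
    max_degree (G \<restriction> S) < chromatic_number (G \<restriction> S) + k)"
proof -
  interpret graph G by fact
  have "\<And>a b. int a \<le> int b + int k - 1 \<longleftrightarrow> a < b + k" by linarith
  with assms show ?thesis
    using all_induced_subgraph_iff[of "\<lambda>H. verts H \<noteq> {} \<longrightarrow>
      max_degree H < chromatic_number H + k"]
    by (simp add: Upsilon_class_def imp_conjL)
qed

section \<open>Degree, clique number and chromatic number\<close>

lemma (in wf_digraph) neighborhood_subset: "neighborhood G v \<subseteq> verts G"
  by (auto simp: neighborhood_def)

lemma (in loopfree_digraph) not_in_own_neighborhood: "v \<notin> neighborhood G v"
  using adj_not_same by (auto simp: neighborhood_def)

text \<open>Without parallel arcs, \<open>head\<close> is injective on the arcs leaving
  \<open>v\<close>.\<close>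

lemma (in nomulti_digraph) out_degree_eq_card_neighborhood:
  "out_degree G v = card (neighborhood G v)"
proof -
  have "bij_betw (head G) (out_arcs G v) (neighborhood G v)"
  proof (rule bij_betwI')
    fix a b assume "a \<in> out_arcs G v" "b \<in> out_arcs G v"
    then show "head G a = head G b \<longleftrightarrow> a = b"
      using no_multi_arcs[of a b] by (auto simp: arc_to_ends_def)
  qed (auto simp: neighborhood_def arcs_ends_def arc_to_ends_def)
  then show ?thesis by (auto simp: out_degree_def bij_betw_same_card)
qed

lemma (in fin_digraph) out_degree_le_max_degree:
  "v \<in> verts G \<Longrightarrow> out_degree G v \<le> max_degree G"
  by (simp add: max_degree_def)

lemma (in fin_digraph) max_degree_attained:
  assumes "verts G \<noteq> {}"
  obtains v where "v \<in> verts G" "out_degree G v = max_degree G"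
proof -
  have "max_degree G \<in> out_degree G ` verts G"
    unfolding max_degree_def using assms by (intro Max_in) auto
  with that show ?thesis by auto
qed

lemma (in digraph) max_degree_less_card_verts:
  assumes "verts G \<noteq> {}"
  shows "max_degree G < card (verts G)"
proof -
  obtain v where v: "v \<in> verts G" "out_degree G v = max_degree G"
    using max_degree_attained[OF assms] .
  then have "neighborhood G v \<subset> verts G"
    using neighborhood_subset not_in_own_neighborhood by blast
  then show ?thesis
    using v out_degree_eq_card_neighborhood by (metis finite_verts psubset_card_mono)
qed

lemma (in fin_digraph) finite_cliques: "finite {S. is_clique G S}"
  by (rule finite_subset[of _ "Pow (verts G)"]) (auto simp: is_clique_def)

lemma (in fin_digraph) card_clique_le: "is_clique G S \<Longrightarrow> card S \<le> clique_number G"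
  unfolding clique_number_def using finite_cliques by simp

lemma (in fin_digraph) max_clique:
  obtains S where "is_clique G S" "card S = clique_number G"
proof -
  \<comment> \<open>The empty clique makes the maximum well defined, even for the null
    graph.\<close>
  have "is_clique G {}" by (simp add: is_clique_def)
  then have "clique_number G \<in> card ` {S. is_clique G S}"
    unfolding clique_number_def using finite_cliques by (intro Max_in) auto
  with that show ?thesis by auto
qed

lemma chromatic_number_le: "proper_coloring G k c \<Longrightarrow> chromatic_number G \<le> k"
  unfolding chromatic_number_def by (auto intro: Least_le)

text \<open>The \<open>LEAST\<close> is attained once some proper colouring exists; giving all
  vertices distinct colours supplies one.\<close>

lemma (in digraph) optimal_coloring:
  obtains c where "proper_coloring G (chromatic_number G) c"
proof -
  obtain c :: "'a \<Rightarrow> nat" where "inj_on c (verts G)" "c ` verts G = {0..<card (verts G)}"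
    using ex_bij_betw_finite_nat[OF finite_verts] by (auto simp: bij_betw_def)
  then have "proper_coloring G (card (verts G)) c"
    using adj_not_same by (auto simp: proper_coloring_def inj_on_def)
  then have "\<exists>k c. proper_coloring G k c" by blast
  then have "\<exists>c. proper_coloring G (chromatic_number G) c"
    unfolding chromatic_number_def by (rule LeastI_ex)
  with that show ?thesis by auto
qed

text \<open>A proper colouring is injective on a clique.\<close>

lemma clique_number_le_chromatic_number:
  assumes "graph G"
  shows "clique_number G \<le> chromatic_number G"
proof -
  interpret graph G by fact
  obtain S where S: "is_clique G S" "card S = clique_number G" using max_clique .
  obtain c where c: "proper_coloring G (chromatic_number G) c" using optimal_coloring .
  have "card S \<le> card {..<chromatic_number G}"
  proof (rule card_inj_on_le)
    show "inj_on c S"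
      using S(1) c unfolding inj_on_def is_clique_def proper_coloring_def by blast
    show "c ` S \<subseteq> {..<chromatic_number G}"
      using S(1) c by (auto simp: is_clique_def proper_coloring_def)
  qed simp
  with S(2) show ?thesis by simp
qed

lemma clique_number_induce_le:
  assumes "graph G" "S \<subseteq> verts G"
  shows "clique_number (G \<restriction> S) \<le> clique_number G"
proof -
  interpret graph G by fact
  interpret GS: graph "G \<restriction> S" using assms by (rule graph_induce)
  obtain C where "is_clique (G \<restriction> S) C" "card C = clique_number (G \<restriction> S)" using GS.max_clique .
  then show ?thesis
    using assms(2) card_clique_le[of C] by (auto simp: is_clique_def adj_induce_iff)
qed

text \<open>An optimal colouring of \<open>S\<close> extends by giving each remaining vertex a
  colour of its own. This is the monotonicity of order minus chromatic number, written without
  subtraction.\<close>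

lemma chromatic_number_le_induce:
  assumes "graph G" "S \<subseteq> verts G"
  shows "chromatic_number G \<le> chromatic_number (G \<restriction> S) + card (verts G - S)"
proof -
  interpret graph G by fact
  interpret GS: graph "G \<restriction> S" using assms by (rule graph_induce)
  let ?k = "chromatic_number (G \<restriction> S)"
  obtain c where c: "proper_coloring (G \<restriction> S) ?k c" using GS.optimal_coloring .
  obtain d :: "'a \<Rightarrow> nat" where
    d: "inj_on d (verts G - S)" "d ` (verts G - S) = {0..<card (verts G - S)}"
    using ex_bij_betw_finite_nat[of "verts G - S"] finite_verts by (auto simp: bij_betw_def)
  have "proper_coloring G (?k + card (verts G - S)) (\<lambda>v. if v \<in> S then c v else ?k + d v)"
    unfolding proper_coloring_def
  proof (intro conjI ballI impI)
    fix v assume "v \<in> verts G"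
    then show "(if v \<in> S then c v else ?k + d v) < ?k + card (verts G - S)"
      using c d(2) by (auto simp: proper_coloring_def)
  next
    fix u v assume uv: "u \<in> verts G" "v \<in> verts G" "u \<rightarrow>\<^bsub>G\<^esub> v"
    then have "u \<noteq> v" using adj_not_same by auto
    then have "d u \<noteq> d v" if "u \<notin> S" "v \<notin> S" using that uv d(1) by (auto dest: inj_onD)
    moreover have "c u < ?k" if "u \<in> S" using c that by (simp add: proper_coloring_def)
    moreover have "c v < ?k" if "v \<in> S" using c that by (simp add: proper_coloring_def)
    moreover have "c u \<noteq> c v" if "u \<in> S" "v \<in> S"
      using c that uv(3) by (simp add: proper_coloring_def adj_induce_iff)
    ultimately show "(if u \<in> S then c u else ?k + d u) \<noteq> (if v \<in> S then c v else ?k + d v)"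
      by (auto split: if_splits)
  qed
  then show ?thesis by (rule chromatic_number_le)
qed

section \<open>Dominating vertices\<close>

text \<open>The degree of \<open>v\<close> already reaches the general upper bound, the order minus
  one.\<close>

lemma max_degree_dominating:
  assumes "graph G" "v \<in> verts G" "neighborhood G v = verts G - {v}"
  shows "Suc (max_degree G) = card (verts G)"
proof -
  interpret graph G by fact
  have "out_degree G v = card (verts G) - 1"
    using assms out_degree_eq_card_neighborhood by simp
  then show ?thesis
    using out_degree_le_max_degree[OF assms(2)] max_degree_less_card_verts assms(2) by fastforce
qed

text \<open>Deleting \<open>v\<close> from a clique leaves a clique of the neighbourhood, and
  \<open>v\<close> can be added to any clique there.\<close>

lemma clique_number_dominating:
  assumes "graph G" "v \<in> verts G" "neighborhood G v = verts G - {v}"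
  shows "clique_number G = Suc (clique_number (G \<restriction> neighborhood G v))"
proof (rule antisym)
  interpret graph G by fact
  let ?N = "neighborhood G v"
  interpret N: graph "G \<restriction> ?N" using assms(1) neighborhood_subset by (rule graph_induce)
  obtain S where S: "is_clique G S" "card S = clique_number G" using max_clique .
  then have "is_clique (G \<restriction> ?N) (S - {v})"
    using assms(3) by (auto simp: is_clique_def adj_induce_iff)
  from N.card_clique_le[OF this] show "clique_number G \<le> Suc (clique_number (G \<restriction> ?N))"
    using S(2) by (simp add: card_Diff_singleton_if split: if_splits)
  obtain T where T: "is_clique (G \<restriction> ?N) T" "card T = clique_number (G \<restriction> ?N)" using N.max_clique .
  then have "T \<subseteq> ?N" by (simp add: is_clique_def)
  then have "v \<notin> T" "finite T" using assms(3) finite_subset[of T "verts G"] by auto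
  moreover have "is_clique G (insert v T)"
    using T(1) assms(2) \<open>T \<subseteq> ?N\<close> graph_symmetric
    by (auto simp: is_clique_def adj_induce_iff neighborhood_def)
  ultimately show "Suc (clique_number (G \<restriction> ?N)) \<le> clique_number G"
    using card_clique_le T(2) by force
qed

lemma chromatic_number_dominating:
  assumes "graph G" "v \<in> verts G" "neighborhood G v = verts G - {v}"
  shows "chromatic_number G = Suc (chromatic_number (G \<restriction> neighborhood G v))"
proof (rule antisym)
  interpret graph G by fact
  let ?N = "neighborhood G v"
  have "verts G - ?N = {v}" using assms(2,3) by auto
  then show "chromatic_number G \<le> Suc (chromatic_number (G \<restriction> ?N))"
    using chromatic_number_le_induce[OF assms(1) neighborhood_subset[of v]] by simp
  let ?k = "chromatic_number G"
  obtain c where c: "proper_coloring G ?k c" using optimal_coloring .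
  then have "c v < ?k" using assms(2) by (simp add: proper_coloring_def)
  have other: "c u < ?k" "c u \<noteq> c v" if "u \<in> ?N" for u
    using c that assms(2) unfolding proper_coloring_def neighborhood_def by (simp, metis mem_Collect_eq)
  \<comment> \<open>The colour of \<open>v\<close> does not occur on its neighbourhood. Shifting the
    larger colours down by one closes this gap and keeps distinct colours distinct.\<close>
  have "proper_coloring (G \<restriction> ?N) (?k - 1) (\<lambda>u. if c u < c v then c u else c u - 1)"
    unfolding proper_coloring_def induce_subgraph_verts
  proof (intro conjI ballI impI)
    fix u assume "u \<in> ?N"
    from other[OF this] show "(if c u < c v then c u else c u - 1) < ?k - 1"
      using \<open>c v < ?k\<close> by auto
  next
    fix u w assume uw: "u \<in> ?N" "w \<in> ?N" "u \<rightarrow>\<^bsub>G \<restriction> ?N\<^esub> w"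
    then have "c u \<noteq> c w"
      using c by (auto simp: proper_coloring_def adj_induce_iff neighborhood_def)
    then show "(if c u < c v then c u else c u - 1) \<noteq> (if c w < c v then c w else c w - 1)"
      using other(2)[OF uw(1)] other(2)[OF uw(2)] by auto
  qed
  then have "chromatic_number (G \<restriction> ?N) \<le> ?k - 1" by (rule chromatic_number_le)
  with \<open>c v < ?k\<close> show "Suc (chromatic_number (G \<restriction> ?N)) \<le> ?k" by simp
qed

lemma neighborhood_induce: "v \<in> S \<Longrightarrow> S \<subseteq> verts G \<Longrightarrow>
    neighborhood (G \<restriction> S) v = neighborhood G v \<inter> S"
  by (auto simp: neighborhood_def adj_induce_iff)

text \<open>In the subgraph induced by \<open>insert v W\<close> the vertex \<open>v\<close> is
  dominating, with neighbourhood exactly \<open>W\<close>. Both directions of the theorem compare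
  the three parameters on such subgraphs.\<close>

lemma induce_insert_dominating:
  assumes "graph G" "v \<in> verts G" "W \<subseteq> neighborhood G v"
  shows "max_degree (G \<restriction> insert v W) = card W"
    and "clique_number (G \<restriction> insert v W) = Suc (clique_number (G \<restriction> W))"
    and "chromatic_number (G \<restriction> insert v W) = Suc (chromatic_number (G \<restriction> W))"
proof -
  interpret graph G by fact
  have sub: "insert v W \<subseteq> verts G" using assms(2,3) neighborhood_subset by blast
  have "v \<notin> W" using assms(3) not_in_own_neighborhood by blast
  have g: "graph (G \<restriction> insert v W)" using assms(1) sub by (rule graph_induce)
  have v: "v \<in> verts (G \<restriction> insert v W)" by simp
  have N: "neighborhood (G \<restriction> insert v W) v = W"
    using sub assms(3) not_in_own_neighborhood by (auto simp: neighborhood_induce)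
  then have N': "neighborhood (G \<restriction> insert v W) v = verts (G \<restriction> insert v W) - {v}"
    using \<open>v \<notin> W\<close> by simp
  have "finite W" using sub finite_subset[of W "verts G"] by auto
  then show "max_degree (G \<restriction> insert v W) = card W"
    using max_degree_dominating[OF g v N'] \<open>v \<notin> W\<close> by simp
  have I: "(G \<restriction> insert v W) \<restriction> W = G \<restriction> W" by (rule induce_induce) auto
  show "clique_number (G \<restriction> insert v W) = Suc (clique_number (G \<restriction> W))"
    using clique_number_dominating[OF g v N'] by (simp only: N I)
  show "chromatic_number (G \<restriction> insert v W) = Suc (chromatic_number (G \<restriction> W))"
    using chromatic_number_dominating[OF g v N'] by (simp only: N I)
qed

section \<open>Neighborhood perfect graphs\<close>

lemma neighborhood_perfect_iff:
  assumes "graph G"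
  shows "neighborhood_perfect G \<longleftrightarrow> (\<forall>v\<in>verts G. \<forall>W\<subseteq>neighborhood G v.
    clique_number (G \<restriction> W) = chromatic_number (G \<restriction> W))"
proof -
  interpret graph G by fact
  have "perfect_graph (G \<restriction> neighborhood G v) \<longleftrightarrow> (\<forall>W\<subseteq>neighborhood G v.
    clique_number (G \<restriction> W) = chromatic_number (G \<restriction> W))" for v
    using perfect_graph_iff[OF graph_induce[OF assms neighborhood_subset]]
    by (simp add: induce_induce)
  then show ?thesis by (simp add: neighborhood_perfect_def)
qed

text \<open>The clique number is at most the chromatic number in every induced subgraph.\<close>

lemma Omega_class_subset_Upsilon_class: "Omega_class k \<subseteq> Upsilon_class k"
proof
  fix G :: "('a, 'b) pre_digraph" assume G: "G \<in> Omega_class k"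
  then have g: "graph G" by (simp add: Omega_class_def)
  have "clique_number (G \<restriction> S) \<le> chromatic_number (G \<restriction> S)" if "S \<subseteq> verts G" for S
    using clique_number_le_chromatic_number graph_induce[OF g that] .
  with G show "G \<in> Upsilon_class k"
    unfolding Omega_class_iff[OF g] Upsilon_class_iff[OF g]
    by (meson add_le_mono1 order_less_le_trans)
qed

text \<open>A neighbourhood in \<open>G \<restriction> S\<close> is part of the neighbourhood in
  \<open>G\<close>, and perfection passes to subsets.\<close>

lemma neighborhood_perfect_induce:
  assumes "graph G" "neighborhood_perfect G" "S \<subseteq> verts G"
  shows "neighborhood_perfect (G \<restriction> S)"
proof -
  have "clique_number ((G \<restriction> S) \<restriction> W) = chromatic_number ((G \<restriction> S) \<restriction> W)"
    if "v \<in> S" "W \<subseteq> neighborhood (G \<restriction> S) v" for v W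
  proof -
    have "W \<subseteq> neighborhood G v" "W \<subseteq> S"
      using that assms(3) by (auto simp: neighborhood_induce)
    moreover have "v \<in> verts G" using that(1) assms(3) by blast
    ultimately show ?thesis
      using assms(1,2) by (simp add: neighborhood_perfect_iff induce_induce)
  qed
  then show ?thesis
    unfolding neighborhood_perfect_iff[OF graph_induce[OF assms(1,3)]] by simp
qed

lemma Upsilon_class_imp_Omega_class:
  assumes "neighborhood_perfect G" "G \<in> Upsilon_class k"
  shows "G \<in> Omega_class k"
proof -
  have g: "graph G" using assms(2) by (simp add: Upsilon_class_def)
  show ?thesis
    unfolding Omega_class_iff[OF g]
  proof (intro allI impI)
    fix S assume S: "S \<subseteq> verts G" "S \<noteq> {}"
    let ?F = "G \<restriction> S"
    interpret F: graph ?F using g S(1) by (rule graph_induce)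
    obtain v where v: "v \<in> verts ?F" "out_degree ?F v = max_degree ?F"
      using F.max_degree_attained S(2) by auto
    let ?W = "neighborhood ?F v"
    note dom = induce_insert_dominating[OF F.graph_axioms v(1) order_refl]
    have sub: "insert v ?W \<subseteq> S" using v(1) F.neighborhood_subset by auto
    then have I: "?F \<restriction> insert v ?W = G \<restriction> insert v ?W" by (rule induce_induce)
    have "max_degree ?F = max_degree (G \<restriction> insert v ?W)"
      using dom(1) v(2) I F.out_degree_eq_card_neighborhood by simp
    \<comment> \<open>The hypothesis is applied to the closed neighbourhood instead of
      \<open>S\<close>, because there neighbourhood perfection makes the chromatic number equal to
      the clique number.\<close>
    also have "\<dots> < chromatic_number (G \<restriction> insert v ?W) + k"
      using assms(2) sub S(1) unfolding Upsilon_class_iff[OF g] by blast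
    also have "chromatic_number (G \<restriction> insert v ?W) = clique_number (?F \<restriction> insert v ?W)"
      using neighborhood_perfect_induce[OF g assms(1) S(1)] v(1) dom(2,3) I
      unfolding neighborhood_perfect_iff[OF F.graph_axioms] by auto
    also have "\<dots> \<le> clique_number ?F"
      using F.graph_axioms sub by (intro clique_number_induce_le) auto
    finally show "max_degree ?F < clique_number ?F + k" by simp
  qed
qed

text \<open>Supplies the contrapositive of the step from equal classes to perfect neighbourhoods:
  the separating subgraph is induced in \<open>G\<close>.\<close>

lemma imperfect_neighborhood_separates:
  assumes "graph G" "v \<in> verts G" "W \<subseteq> neighborhood G v"
    and imperfect: "clique_number (G \<restriction> W) \<noteq> chromatic_number (G \<restriction> W)"
  shows "\<exists>k. G \<restriction> insert v W \<in> Upsilon_class k - Omega_class k"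
proof -
  interpret graph G by fact
  let ?H = "G \<restriction> insert v W"
  have sub: "insert v W \<subseteq> verts G" using assms(2,3) neighborhood_subset by blast
  then have W: "W \<subseteq> verts G" "finite W" using finite_subset[of W "verts G"] by auto
  have g: "graph ?H" using assms(1) sub by (rule graph_induce)
  \<comment> \<open>Additive form of the claim that order minus chromatic number does not increase
    from \<open>W\<close> to \<open>T\<close>.\<close>
  have deletion: "chromatic_number (G \<restriction> W) + card T \<le> chromatic_number (G \<restriction> T) + card W"
    if "T \<subseteq> W" for T
  proof -
    have "chromatic_number (G \<restriction> W) \<le> chromatic_number (G \<restriction> T) + card (W - T)"
      using chromatic_number_le_induce[OF graph_induce[OF assms(1) W(1)]] that
      by (simp add: induce_induce)
    moreover have "card (W - T) + card T = card W"
      using that W(2) by (simp add: card_Diff_subset finite_subset card_mono)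
    ultimately show ?thesis by linarith
  qed
  \<comment> \<open>Take \<open>T\<close> empty: any function, here \<open>undefined\<close>,
    colours the null graph with 0 colours. The bound makes the difference \<open>k\<close> a natural
    number.\<close>
  have "chromatic_number (G \<restriction> W) \<le> card W"
    using deletion[of "{}"] chromatic_number_le[of "G \<restriction> {}" 0 undefined]
    by (simp add: proper_coloring_def)
  then obtain k where k: "card W = chromatic_number (G \<restriction> W) + k" using le_iff_add by blast
  have "?H \<in> Upsilon_class k"
    unfolding Upsilon_class_iff[OF g]
  proof (intro allI impI)
    fix S assume S: "S \<subseteq> verts ?H" "S \<noteq> {}"
    have I: "?H \<restriction> S = G \<restriction> S" using S(1) by (simp add: induce_induce)
    \<comment> \<open>If \<open>v\<close> is in \<open>S\<close>, it is dominating: the maximum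
      degree is \<open>card T\<close>, and the one colour added by \<open>v\<close> makes the bound
      strict. Otherwise strictness comes from the maximum degree being below the order of
      \<open>G \<restriction> S\<close>.\<close>
    have "max_degree (G \<restriction> S) < chromatic_number (G \<restriction> S) + k"
    proof (cases "v \<in> S")
      case True
      define T where "T = S - {v}"
      have T: "T \<subseteq> W" "S = insert v T" using S(1) True by (auto simp: T_def)
      then have "T \<subseteq> neighborhood G v" using assms(3) by blast
      from induce_insert_dominating[OF assms(1,2) this] deletion[OF T(1)] k T(2)
      show ?thesis by simp
    next
      case False
      then have "S \<subseteq> W" using S(1) by auto
      then interpret S: graph "G \<restriction> S" using assms(1) W(1) by (intro graph_induce) auto
      show ?thesis
        using S.max_degree_less_card_verts S(2) deletion[OF \<open>S \<subseteq> W\<close>] k by simp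
    qed
    then show "max_degree (?H \<restriction> S) < chromatic_number (?H \<restriction> S) + k" by (simp only: I)
  qed
  \<comment> \<open>The whole of \<open>?H\<close> is the violation: its maximum degree is
    \<open>card W\<close>, which is the chromatic number of \<open>G \<restriction> W\<close> plus
    \<open>k\<close>. Imperfection makes this at least the clique number of \<open>?H\<close> plus
    \<open>k\<close>.\<close>
  moreover have "?H \<notin> Omega_class k"
  proof
    assume "?H \<in> Omega_class k"
    then have "max_degree ?H < clique_number ?H + k"
      unfolding Omega_class_iff[OF g] by (auto simp: induce_induce dest!: spec[of _ "insert v W"])
    moreover have "clique_number (G \<restriction> W) < chromatic_number (G \<restriction> W)"
      using clique_number_le_chromatic_number[OF graph_induce[OF assms(1) W(1)]] imperfect by simp
    ultimately show False
      using induce_insert_dominating[OF assms(1-3)] k by simp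
  qed
  ultimately show ?thesis by blast
qed

theorem theorem8:
  fixes G :: "('a, 'b) pre_digraph"
  assumes "graph G"
  shows "neighborhood_perfect G \<longleftrightarrow>
    (\<forall>k::nat. \<forall>H. induced_subgraph H G \<longrightarrow> (H \<in> Omega_class k \<longleftrightarrow> H \<in> Upsilon_class k))"
proof
  interpret graph G by fact
  assume np: "neighborhood_perfect G"
  show "\<forall>k. \<forall>H. induced_subgraph H G \<longrightarrow> (H \<in> Omega_class k \<longleftrightarrow> H \<in> Upsilon_class k)"
  proof (intro allI impI)
    fix k H assume "induced_subgraph H G"
    then have "neighborhood_perfect H"
      using neighborhood_perfect_induce[OF assms np] unfolding induced_subgraph_iff by metis
    then show "H \<in> Omega_class k \<longleftrightarrow> H \<in> Upsilon_class k"
      using Upsilon_class_imp_Omega_class Omega_class_subset_Upsilon_class by blast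
  qed
next
  interpret graph G by fact
  assume eq: "\<forall>k. \<forall>H. induced_subgraph H G \<longrightarrow> (H \<in> Omega_class k \<longleftrightarrow> H \<in> Upsilon_class k)"
  show "neighborhood_perfect G"
    unfolding neighborhood_perfect_iff[OF assms]
  proof (intro ballI allI impI)
    fix v W assume vW: "v \<in> verts G" "W \<subseteq> neighborhood G v"
    then have "induced_subgraph (G \<restriction> insert v W) G"
      using neighborhood_subset by (intro induced_induce) blast
    with eq show "clique_number (G \<restriction> W) = chromatic_number (G \<restriction> W)"
      using imperfect_neighborhood_separates[OF assms vW] by blast
  qed
qed

end
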